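(* Fix a positive integer $m$. Then, for degree sequences $d=(d_1,\ldots,d_n)$ all of whose entries satisfy $d_i\leq m$, the complexity $\#C(d)$ of the recursive enumeration of the labeled graphs realizing $d$ is $\mathcal{O}(n^{mn})$ as a function of the length $n$ (with $m$ fixed, so that the implied constant may depend on $m$ but not on $n$ or $d$). In particular, the enumeration complexity for $m$-regular graphs on $n$ vertices, that is, $\#C(d)$ for the degree sequence $d=(m,\ldots,m)$ of length $n$, is also $\mathcal{O}(n^{mn})$.
   Context: All graphs are simple, labeled and undirected. A degree sequence is a finite non-increasing sequence of strictly positive integers $d=(d_1,\ldots,d_n)$ for which there is a graph on vertices $v_1,\ldots,v_n$ with $\deg(v_i)=d_i$ for all $i$; such a graph is said to realize $d$. $C(d)$ denotes the number of labeled graphs on $\{v_1,\ldots,v_n\}$ realizing $d$. For a finite non-increasing sequence of strictly positive integers $(d_1,\ldots,d_n)$ and a subset $S\subseteq\{1,\ldots,n-1\}$ with characteristic function $\chi_S$, write $(d_1,\ldots,d_{n-1})/S$ for the sequence obtained from $(d_1-\chi_S(1),\ldots,d_{n-1}-\chi_S(n-1))$ by reordering it in non-increasing order and removing all entries equal to $0$. The recursive enumeration computes $C(d)$ by the recurrence $$C((d_1,\ldots,d_n)) = \sum_{S\in\binom{\{1,\ldots,n-1\}}{d_n}} C\bigl((d_1,\ldots,d_{n-1})/ S\bigr),$$ where $\binom{X}{k}$ is the set of all $k$-element subsets of $X$, with $C(\epsilon)=1$ for the empty sequence $\epsilon$ and $C((d_1))=0$ for a one-term sequence with $d_1>0$.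 The recursion tree of $d$ has root $d$; a node labeled by a nonempty sequence $(e_1,\ldots,e_k)$ has one child for each $S\in\binom{\{1,\ldots,k-1\}}{e_k}$, labeled by $(e_1,\ldots,e_{k-1})/S$ (distinct $S$ give distinct children, even if the labels coincide); nodes labeled $\epsilon$ have no children. The complexity measure $\#C(d)$ is the total number of summands obtained when the recurrence is fully expanded, i.e. the number of leaves (nodes without children) of this recursion tree. *)

theory Defs
  imports Complex_Main "HOL-Library.Multiset" "HOL-Library.Landau_Symbols"
begin

text \<open>A sequence \<open>(d\<^sub>1, \<dots>, d\<^sub>n)\<close> is represented by a list \<open>d\<close> with \<open>d\<^sub>i = d ! (i - 1)\<close>; vertices and
  positions are numbered from 1. A simple graph is given by its set of edges, each edge being a
  two-element set of vertices.\<close>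

definition simple_graph_on :: "nat set \<Rightarrow> nat set set \<Rightarrow> bool" where
  "simple_graph_on V E \<longleftrightarrow> (\<forall>e\<in>E. e \<subseteq> V \<and> card e = 2)"

definition vertex_degree :: "nat set set \<Rightarrow> nat \<Rightarrow> nat" where
  "vertex_degree E v = card {e \<in> E. v \<in> e}"

definition realizes :: "nat set set \<Rightarrow> nat list \<Rightarrow> bool" where
  "realizes E d \<longleftrightarrow> simple_graph_on {1..length d} E \<and>
     (\<forall>i\<in>{1..length d}. vertex_degree E i = d ! (i - 1))"

definition degree_sequence :: "nat list \<Rightarrow> bool" where
  "degree_sequence d \<longleftrightarrow> sorted_wrt (\<ge>) d \<and> (\<forall>x\<in>set d. x > 0) \<and> (\<exists>E. realizes E d)"

text \<open>\<open>(e\<^sub>1, \<dots>, e\<^bsub>k-1\<^esub>)/S\<close>, as a function of the whole sequence \<open>(e\<^sub>1, \<dots>, e\<^sub>k)\<close>, whose last entry is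
  dropped. The truncated subtraction is harmless since all entries are positive.\<close>

definition reduce_seq :: "nat list \<Rightarrow> nat set \<Rightarrow> nat list" where
  "reduce_seq e S =
     rev (sort (filter (\<lambda>x. x > 0) (map (\<lambda>i. e ! (i - 1) - of_bool (i \<in> S)) [1..<length e])))"

definition choices :: "nat list \<Rightarrow> nat set set" where
  "choices e = {S. S \<subseteq> {1..length e - 1} \<and> card S = last e}"

text \<open>The children of a node form a multiset, so that distinct \<open>S\<close> contribute distinct children even
  if their labels coincide.\<close>

datatype rec_tree = Node (label: "nat list") (children: "rec_tree multiset")

lemma length_reduce_seq_less: "e \<noteq> [] \<Longrightarrow> length (reduce_seq e S) < length e"
  unfolding reduce_seq_def
  by (auto intro!: le_less_trans[OF length_filter_le] simp: length_greater_0_conv[symmetric]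
      simp del: length_greater_0_conv)

function recursion_tree :: "nat list \<Rightarrow> rec_tree" where
  "recursion_tree e =
     Node e (if e = [] then {#}
             else image_mset (\<lambda>S. recursion_tree (reduce_seq e S)) (mset_set (choices e)))"
  by auto
termination
  by (relation "measure length") (auto simp: length_reduce_seq_less)

declare recursion_tree.simps [simp del]

primrec num_leaves :: "rec_tree \<Rightarrow> nat" where
  "num_leaves (Node e ts) =
     (if ts = {#} then 1 else sum_mset (image_mset num_leaves ts))"

definition complexity :: "nat list \<Rightarrow> nat" where
  "complexity d = num_leaves (recursion_tree d)"

lemma finite_choices: "finite (choices e)"
  by (rule finite_subset[of _ "Pow {1..length e - 1}"]) (auto simp: choices_def)

lemma complexity_rec:
  "complexity e =
     (if e = [] \<or> choices e = {} then 1 else (\<Sum>S\<in>choices e. complexity (reduce_seq e S)))"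
  unfolding complexity_def
  by (subst recursion_tree.simps)
     (auto simp: mset_set_empty_iff finite_choices sum_unfold_sum_mset image_mset.compositionality o_def)

text \<open>Sequences of length tending to infinity within the class of degree sequences with entries
  at most \<open>m\<close>. A property holds eventually along this filter iff there is an \<open>N\<close> such that it holds
  for all such sequences of length at least \<open>N\<close>; hence a bound \<open>O\<close> along it has one constant, uniform
  in all these sequences.\<close>

definition bounded_degree_seqs :: "nat \<Rightarrow> nat list filter" where
  "bounded_degree_seqs m =
     inf (filtercomap length at_top) (principal {d. degree_sequence d \<and> (\<forall>x\<in>set d. x \<le> m)})"

lemma eventually_bounded_degree_seqs:
  "eventually P (bounded_degree_seqs m) \<longleftrightarrow>
     (\<exists>N. \<forall>d. length d \<ge> N \<longrightarrow> degree_sequence d \<longrightarrow> (\<forall>x\<in>set d. x \<le> m) \<longrightarrow> P d)"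
  unfolding bounded_degree_seqs_def eventually_inf_principal eventually_filtercomap_at_top_linorder
  by auto

end

theory Submission
  imports Defs
begin

text \<open>A node of length \<open>k\<close> whose last entry is at most \<open>m\<close> has at most \<open>k ^ m\<close> children, and every
  child is strictly shorter with entries still at most \<open>m\<close>. Descending from a root of length \<open>n\<close>,
  the lengths are therefore distinct elements of \<open>{1..n}\<close> before the empty sequence is reached, so
  the number of leaves is at most \<open>1 ^ m * 2 ^ m * \<dots> * n ^ m = fact n ^ m \<le> n ^ (m * n)\<close>. The
  implied constant is 1, uniformly in all lengths.\<close>

lemma set_reduce_seq_le:
  assumes "\<forall>x\<in>set e. x \<le> m" and "x \<in> set (reduce_seq e S)"
  shows "x \<le> m"
proof -
  obtain i where i: "i \<in> {1..<length e}" and x: "x = e ! (i - 1) - of_bool (i \<in> S)"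
    using assms(2) by (auto simp: reduce_seq_def)
  have "x \<le> e ! (i - 1)"
    using x by simp
  also have "e ! (i - 1) \<in> set e"
    using i by (intro nth_mem) auto
  then have "e ! (i - 1) \<le> m"
    using assms(1) by blast
  finally show ?thesis .
qed

lemma card_choices_le:
  assumes "e \<noteq> []" and "\<forall>x\<in>set e. x \<le> m"
  shows "card (choices e) \<le> length e ^ m"
proof (cases "last e \<le> length e - 1")
  case True
  have "card (choices e) = (length e - 1) choose last e"
    unfolding choices_def by (subst n_subsets) simp_all
  also have "\<dots> \<le> (length e - 1) ^ last e"
    using True by (rule binomial_le_pow)
  also have "\<dots> \<le> length e ^ last e"
    by (intro power_mono) simp_all
  also have "\<dots> \<le> length e ^ m"
    using assms by (intro power_increasing) (simp_all add: Suc_le_eq)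
  finally show ?thesis .
next
  case False
  have "card (choices e) = (length e - 1) choose last e"
    unfolding choices_def by (subst n_subsets) simp_all
  then show ?thesis
    using False by (simp add: binomial_eq_0)
qed

text \<open>The factorial absorbs the induction on the length: the factor \<open>k ^ m\<close> for the children is
  exactly the quotient \<open>fact k ^ m / fact (k - 1) ^ m\<close>, and monotonicity of the factorial covers
  children that lose further entries by the removal of zeros.\<close>

lemma complexity_le_fact_power:
  assumes "\<forall>x\<in>set e. x \<le> m"
  shows "complexity e \<le> fact (length e) ^ m"
  using assms
proof (induction e rule: measure_induct_rule[of length])
  case (less e)
  show ?case
  proof (cases "e = [] \<or> choices e = {}")
    case True
    then show ?thesis
      by (subst complexity_rec) (auto simp: Suc_le_eq)
  next
    case False
    then have e: "e \<noteq> []"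
      by simp
    have child: "complexity (reduce_seq e S) \<le> fact (length e - 1) ^ m" for S
    proof -
      have len: "length (reduce_seq e S) < length e"
        using e by (rule length_reduce_seq_less)
      have "complexity (reduce_seq e S) \<le> fact (length (reduce_seq e S)) ^ m"
        using less.IH[OF len] set_reduce_seq_le[OF less.prems] by blast
      also have "\<dots> \<le> fact (length e - 1) ^ m"
        using len by (intro power_mono fact_mono) simp_all
      finally show ?thesis .
    qed
    have "complexity e = (\<Sum>S\<in>choices e. complexity (reduce_seq e S))"
      using False by (subst complexity_rec) simp
    also have "\<dots> \<le> card (choices e) * fact (length e - 1) ^ m"
      using sum_bounded_above[of "choices e" "\<lambda>S. complexity (reduce_seq e S)", OF child] by simp
    also have "\<dots> \<le> length e ^ m * fact (length e - 1) ^ m"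
      using card_choices_le[OF e less.prems] by (intro mult_right_mono) simp_all
    also have "\<dots> = fact (length e) ^ m"
      using e by (simp add: fact_reduce[of "length e"] power_mult_distrib)
    finally show ?thesis .
  qed
qed

corollary complexity_le_length_power:
  assumes "\<forall>x\<in>set e. x \<le> m"
  shows "complexity e \<le> length e ^ (m * length e)"
proof -
  have "complexity e \<le> fact (length e) ^ m"
    using assms by (rule complexity_le_fact_power)
  also have "\<dots> \<le> (length e ^ length e) ^ m"
    using fact_le_power[of "length e", where 'a = nat] by (intro power_mono) simp_all
  also have "\<dots> = length e ^ (m * length e)"
    by (simp add: power_mult[symmetric] mult.commute)
  finally show ?thesis .
qed

theorem proposition1p2:
  fixes m :: nat
  assumes "m > 0"
  shows "(\<lambda>d. real (complexity d)) \<in> O[bounded_degree_seqs m](\<lambda>d. real (length d) ^ (m * length d))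
    \<and> (\<lambda>n. real (complexity (replicate n m)))
        \<in> O[inf at_top (principal {n. degree_sequence (replicate n m)})](\<lambda>n. real n ^ (m * n))"
proof
  have bound: "norm (real (complexity d)) \<le> 1 * norm (real (length d) ^ (m * length d))"
    if "\<forall>x\<in>set d. x \<le> m" for d
    using complexity_le_length_power[OF that] by (simp flip: of_nat_power)
  show "(\<lambda>d. real (complexity d)) \<in> O[bounded_degree_seqs m](\<lambda>d. real (length d) ^ (m * length d))"
    by (rule bigoI[where c = 1]) (use bound in \<open>auto simp: eventually_bounded_degree_seqs\<close>)
  show "(\<lambda>n. real (complexity (replicate n m)))
        \<in> O[inf at_top (principal {n. degree_sequence (replicate n m)})](\<lambda>n. real n ^ (m * n))"
  proof (rule bigoI[where c = 1], rule always_eventually, rule allI)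
    fix n
    show "norm (real (complexity (replicate n m))) \<le> 1 * norm (real n ^ (m * n))"
      using bound[of "replicate n m"] by simp
  qed
qed

end
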